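(* Let $\mathcal{A}$ be a downset in $\mathcal{B}(n)$, and let $\mathcal{I}$ be the set of the first $|\mathcal{A}|$ elements of the level-colex order on $\mathcal{B}(n)$. Then $w(\mathcal{A}) \le w(\mathcal{I})$.
   Context: $\mathcal{B}(n)$ is the Boolean lattice of all subsets of $[n]=\{1,\dots,n\}$ ordered by inclusion. A downset is a family $\mathcal{D}$ such that $X \in \mathcal{D}$ and $Y \subseteq X$ imply $Y \in \mathcal{D}$. The width $w(\mathcal{X})$ of a family $\mathcal{X}$ is the maximum size of an antichain (family of pairwise inclusion-incomparable sets) contained in $\mathcal{X}$. The level-colex order on $\mathcal{B}(n)$ is the total order with $A<B$ if either $|A|<|B|$, or $|A|=|B|$ and $\max(A \triangle B) \in B$. *)

theory Defs
  imports Main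
begin

definition boolean_lattice :: "nat \<Rightarrow> nat set set" where
  "boolean_lattice n = Pow {1..n}"

definition downset :: "'a set set \<Rightarrow> bool" where
  "downset D \<longleftrightarrow> (\<forall>X Y. X \<in> D \<longrightarrow> Y \<subseteq> X \<longrightarrow> Y \<in> D)"

definition antichain :: "'a set set \<Rightarrow> bool" where
  "antichain F \<longleftrightarrow> pairwise (\<lambda>X Y. \<not> X \<subseteq> Y \<and> \<not> Y \<subseteq> X) F"

text \<open>Only meaningful for finite \<open>X\<close>, where the set of cardinalities is finite; it is never
  empty because of the empty antichain.\<close>

definition width :: "'a set set \<Rightarrow> nat" where
  "width X = Max (card ` {F. F \<subseteq> X \<and> antichain F})"

text \<open>The conjunct \<open>A \<noteq> B\<close> is needed because \<open>Max {}\<close> is an unspecified element.\<close>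

definition level_colex_less :: "nat set \<Rightarrow> nat set \<Rightarrow> bool" where
  "level_colex_less A B \<longleftrightarrow>
     card A < card B \<or>
     card A = card B \<and> A \<noteq> B \<and> Max (sym_diff A B) \<in> B"

text \<open>An element is among the first \<open>m\<close> iff it has fewer than \<open>m\<close> predecessors.\<close>

definition level_colex_first :: "nat \<Rightarrow> nat \<Rightarrow> nat set set" where
  "level_colex_first n m =
     {A \<in> boolean_lattice n. card {B \<in> boolean_lattice n. level_colex_less B A} < m}"

lemma finite_boolean_lattice [simp]: "finite (boolean_lattice n)"
  by (simp add: boolean_lattice_def)

lemma boolean_lattice_finite: "A \<in> boolean_lattice n \<Longrightarrow> finite A"
  by (auto simp: boolean_lattice_def intro: finite_subset)

lemma level_colex_less_irrefl: "\<not> level_colex_less A A"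
  by (simp add: level_colex_less_def)

lemma Max_sym_diff_iff:
  fixes A B :: "nat set"
  assumes "finite A" "finite B"
  shows "A \<noteq> B \<and> Max (sym_diff A B) \<in> B \<longleftrightarrow>
         (\<exists>m. m \<in> B \<and> m \<notin> A \<and> (\<forall>k>m. k \<in> A \<longleftrightarrow> k \<in> B))" (is "?L \<longleftrightarrow> ?R")
proof
  let ?S = "sym_diff A B"
  have fin: "finite ?S" using assms by simp
  {
    assume L: ?L
    then have ne: "?S \<noteq> {}" by blast
    have "Max ?S \<in> ?S" using Max_in[OF fin ne] .
    moreover have "k \<in> A \<longleftrightarrow> k \<in> B" if "k > Max ?S" for k
      using Max_ge[OF fin, of k] that by fastforce
    ultimately show ?R using L by blast
  next
    assume ?R
    then obtain m where m: "m \<in> B" "m \<notin> A" "\<forall>k>m. k \<in> A \<longleftrightarrow> k \<in> B" by blast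
    have "Max ?S = m"
    proof (rule Max_eqI[OF fin])
      show "y \<le> m" if "y \<in> ?S" for y using that m(3) by (meson DiffD1 DiffD2 UnE not_le)
    qed (use m in blast)
    then show ?L using m by auto
  }
qed

lemma level_colex_less_trans:
  assumes "finite A" "finite B" "finite C" "level_colex_less A B" "level_colex_less B C"
  shows "level_colex_less A C"
proof (cases "card A = card B \<and> card B = card C")
  case True
  then obtain a b where a: "a \<in> B" "a \<notin> A" "\<forall>k>a. k \<in> A \<longleftrightarrow> k \<in> B"
    and b: "b \<in> C" "b \<notin> B" "\<forall>k>b. k \<in> B \<longleftrightarrow> k \<in> C"
    using assms(4,5) Max_sym_diff_iff[OF assms(1,2)] Max_sym_diff_iff[OF assms(2,3)]
    unfolding level_colex_less_def by (metis less_irrefl)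
  have "a \<noteq> b" using a b by blast
  then have "max a b \<in> C \<and> max a b \<notin> A \<and> (\<forall>k>max a b. k \<in> A \<longleftrightarrow> k \<in> C)"
    using a b by (cases "a < b") (auto simp: max_def)
  then have "A \<noteq> C \<and> Max (sym_diff A C) \<in> C"
    unfolding Max_sym_diff_iff[OF assms(1,3)] by blast
  then show ?thesis using True unfolding level_colex_less_def by simp
qed (use assms in \<open>auto simp: level_colex_less_def\<close>)

lemma level_colex_less_total:
  assumes "finite A" "finite B" "A \<noteq> B"
  shows "level_colex_less A B \<or> level_colex_less B A"
proof -
  have "Max (sym_diff A B) \<in> sym_diff A B"
    using assms by (intro Max_in) auto
  then show ?thesis
    using assms(3) Un_commute[of "A - B" "B - A"] unfolding level_colex_less_def
    by (metis DiffD1 UnE linorder_less_linear)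
qed

lemma level_colex_first_closed:
  assumes "B \<in> level_colex_first n m" "A \<in> boolean_lattice n" "level_colex_less A B"
  shows "A \<in> level_colex_first n m"
proof -
  have "B \<in> boolean_lattice n" using assms by (simp add: level_colex_first_def)
  then have "{C \<in> boolean_lattice n. level_colex_less C A}
               \<subseteq> {C \<in> boolean_lattice n. level_colex_less C B}"
    using assms by (auto intro: level_colex_less_trans[of _ A B] boolean_lattice_finite)
  then have "card {C \<in> boolean_lattice n. level_colex_less C A}
               \<le> card {C \<in> boolean_lattice n. level_colex_less C B}"
    by (intro card_mono) auto
  then show ?thesis using assms by (simp add: level_colex_first_def)
qed

lemma card_level_colex_first:
  assumes "m \<le> card (boolean_lattice n)"
  shows "card (level_colex_first n m) = m"
proof -
  let ?L = "boolean_lattice n"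
  define r where "r A = card {B \<in> ?L. level_colex_less B A}" for A
  have less: "r A < r B" if "A \<in> ?L" "B \<in> ?L" "level_colex_less A B" for A B
  proof -
    have "{C \<in> ?L. level_colex_less C A} \<subseteq> {C \<in> ?L. level_colex_less C B}"
      using that by (auto intro: level_colex_less_trans[of _ A B] boolean_lattice_finite)
    moreover have "A \<notin> {C \<in> ?L. level_colex_less C A}" "A \<in> {C \<in> ?L. level_colex_less C B}"
      using that by (auto simp: level_colex_less_irrefl)
    ultimately have "{C \<in> ?L. level_colex_less C A} \<subset> {C \<in> ?L. level_colex_less C B}"
      by blast
    then show ?thesis unfolding r_def by (intro psubset_card_mono) auto
  qed
  have inj: "inj_on r ?L"
  proof (rule inj_onI, rule ccontr)
    fix A B assume "A \<in> ?L" "B \<in> ?L" "r A = r B" "A \<noteq> B"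
    then show False
      using less level_colex_less_total boolean_lattice_finite by (metis less_irrefl)
  qed
  have "r ` ?L \<subseteq> {..<card ?L}"
  proof
    fix x assume "x \<in> r ` ?L"
    then obtain A where A: "A \<in> ?L" "x = r A" by blast
    then have "{B \<in> ?L. level_colex_less B A} \<subset> ?L"
      using level_colex_less_irrefl by blast
    then show "x \<in> {..<card ?L}" unfolding A(2) r_def by (simp add: psubset_card_mono)
  qed
  then have img: "r ` ?L = {..<card ?L}"
    by (intro card_subset_eq) (auto simp: card_image[OF inj])
  have "level_colex_first n m = {A \<in> ?L. r A < m}"
    by (simp add: level_colex_first_def r_def)
  then have "r ` level_colex_first n m = {x \<in> r ` ?L. x < m}" by auto
  also have "\<dots> = {..<m}" using assms unfolding img by auto
  finally have "r ` level_colex_first n m = {..<m}" .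
  moreover have "inj_on r (level_colex_first n m)"
    using inj by (rule inj_on_subset) (auto simp: level_colex_first_def)
  ultimately show ?thesis by (metis card_image card_lessThan)
qed

end

theory Submission
  imports Defs
begin

text \<open>
  In a downset \<open>D\<close> the set \<open>D - shadow D\<close> of maximal elements is an antichain, and an
  antichain \<open>X\<close> generating \<open>D\<close> has \<open>|X| \<le> |D| - |shadow D|\<close>. So it suffices that, among all
  families of a given size, the initial segments of level-colex minimise the total shadow.
  By Kruskal-Katona each level may be replaced by a colex-initial segment of the same size.
  The shadow of the first \<open>t\<close> sets of level \<open>k\<close> then has size \<open>K n k t = kk_bound n k t\<close>, and for \<open>i \<le> k\<close> the sum
  \<open>K n i a + K n k b\<close> does not increase when as much as possible is moved from level \<open>k\<close> down
  to level \<open>i\<close>. Repeating such moves fills the levels from the bottom, which gives the initial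
  segment of level-colex. The exchange inequality and the inequality of Eckhoff and Wegner behind
  Kruskal-Katona both follow by induction on \<open>n\<close>, because in colex order level \<open>k\<close> of
  \<open>{1..n+1}\<close> is level \<open>k\<close> of \<open>{1..n}\<close> followed by level \<open>k - 1\<close> with \<open>n + 1\<close> added.
\<close>

section \<open>The Kruskal-Katona function\<close>

text \<open>Size of the shadow of the first \<open>t\<close> sets in colex order among the \<open>k\<close>-subsets of
  \<open>{1..n}\<close>; meaningful only for \<open>t \<le> n choose k\<close>.\<close>

fun kk_bound :: "nat \<Rightarrow> nat \<Rightarrow> nat \<Rightarrow> nat" where
  "kk_bound 0 k t = 0"
| "kk_bound (Suc n) 0 t = 0"
| "kk_bound (Suc n) (Suc k) t =
     (if t \<le> n choose Suc k then kk_bound n (Suc k) t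
      else (n choose k) + kk_bound n k (t - (n choose Suc k)))"

lemma kk_bound_level_0 [simp]: "kk_bound n 0 t = 0"
  by (cases n) auto

lemma kk_bound_empty [simp]: "kk_bound n k 0 = 0"
proof (induction n arbitrary: k)
  case (Suc n)
  then show ?case by (cases k) auto
qed simp

text \<open>\<open>Suc k <= n\<close> excludes an empty level: for \<open>k = n\<close> the left
  side is 0 but the right side is 1.\<close>

lemma kk_bound_full: "Suc k \<le> n \<Longrightarrow> kk_bound n (Suc k) (n choose Suc k) = n choose k"
proof (induction n arbitrary: k)
  case (Suc n)
  show ?case
  proof (cases k)
    case 0
    show ?thesis
    proof (cases n)
      case (Suc m)
      then show ?thesis using Suc.IH[of 0] 0 by simp
    qed (use 0 in simp)
  next
    case (Suc j)
    then have "Suc j \<le> n" using Suc.prems by simp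
    then have "kk_bound n k (n choose k) = n choose j" using Suc.IH[of j] Suc by simp
    moreover have "0 < n choose k" using Suc \<open>Suc j \<le> n\<close> by simp
    ultimately show ?thesis using Suc by simp
  qed
qed simp

lemma kk_bound_le: "t \<le> n choose Suc k \<Longrightarrow> kk_bound n (Suc k) t \<le> n choose k"
proof (induction n arbitrary: k t)
  case (Suc n)
  show ?case
  proof (cases "t \<le> n choose Suc k")
    case True
    then have "kk_bound n (Suc k) t \<le> n choose k" by (rule Suc.IH)
    also have "\<dots> \<le> Suc n choose k" by (cases k) auto
    finally show ?thesis using True by simp
  next
    case False
    show ?thesis
    proof (cases k)
      case (Suc j)
      then have "kk_bound n k (t - (n choose Suc k)) \<le> n choose j"
        using Suc.IH[of "t - (n choose Suc k)" j] Suc.prems by simp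
      then show ?thesis using False Suc by simp
    qed (use False in simp)
  qed
qed simp

lemma kk_bound_mono: "s \<le> t \<Longrightarrow> t \<le> n choose k \<Longrightarrow> kk_bound n k s \<le> kk_bound n k t"
proof (induction n arbitrary: k s t)
  case (Suc n)
  show ?case
  proof (cases k)
    case k: (Suc j)
    consider "t \<le> n choose k" | "s \<le> n choose k" "\<not> t \<le> n choose k" | "\<not> s \<le> n choose k"
      by blast
    then show ?thesis
    proof cases
      case 1
      then show ?thesis using Suc.IH[of s t k] Suc.prems k by simp
    next
      case 2
      then show ?thesis using kk_bound_le[of s n j] k by simp
    next
      case 3
      then show ?thesis
        using Suc.IH[of "s - (n choose k)" "t - (n choose k)" j] Suc.prems k by simp
    qed
  qed simp
qed simp

section \<open>Inequalities for moving sets between levels\<close>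

lemma kk_bound_top: "kk_bound n n 1 = n"
  by (induction n) (auto simp: binomial_eq_0)

text \<open>One more set adds at most its own one-element deletions to the shadow. This pays for
  moving the single set of the top level down, since by \<open>kk_bound_top\<close> that set
  contributes exactly \<open>n\<close>.\<close>

lemma kk_bound_step: "t < n choose k \<Longrightarrow> kk_bound n k (Suc t) \<le> kk_bound n k t + n"
proof (induction n arbitrary: k t)
  case (Suc n)
  show ?case
  proof (cases k)
    case k: (Suc j)
    consider "Suc t \<le> n choose k" | "t = n choose k" | "n choose k < t" by linarith
    then show ?thesis
    proof cases
      case 1
      then show ?thesis using Suc.IH[of t k] k by simp
    next
      case 2
      have "0 < n choose j" using Suc.prems 2 k by simp
      then have "kk_bound n j 1 \<le> n" using Suc.IH[of 0 j] by simp
      \<comment> \<open>The \<open>+ 1\<close> covers \<open>j = n\<close>, where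
        \<open>n choose j = 1\<close> but level \<open>k\<close> on \<open>{1..n}\<close> is
        empty.\<close>
      moreover have "n choose j \<le> kk_bound n k t + 1"
        using kk_bound_full[of j n] 2 k
        by (cases "Suc j \<le> n") (auto simp: not_le binomial_eq_0 le_Suc_eq less_Suc_eq)
      ultimately show ?thesis using 2 k by simp
    next
      case 3
      then have "kk_bound n j (Suc (t - (n choose k))) \<le> kk_bound n j (t - (n choose k)) + n"
        using Suc.IH[of "t - (n choose k)" j] Suc.prems k by simp
      then show ?thesis using 3 k by (simp add: Suc_diff_le)
    qed
  qed simp
qed simp

text \<open>The side condition \<open>k < n\<close> excludes the top level, where \<open>n choose Suc k = 0\<close> and the
  left-hand side exceeds the right-hand side by one
  if \<open>y > 0\<close>.\<close>

lemma kk_bound_split: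
  assumes "x \<le> n choose Suc k" "y = 0 \<or> x = n choose Suc k" "k < n"
  shows "kk_bound (Suc n) (Suc k) (x + y) = kk_bound n (Suc k) x + kk_bound n k y"
  using assms kk_bound_full[of k n] by (cases "y = 0") auto

text \<open>The conditions force \<open>a' = min (a + b) (n choose i)\<close>. The existential form
  lets several moves be chained, with the fill conditions left to linear arithmetic.\<close>

lemma kk_bound_exchange:
  assumes "i \<le> k" "a \<le> n choose i" "b \<le> n choose k"
  shows "\<exists>a' b'. a' + b' = a + b \<and> a \<le> a' \<and> a' \<le> n choose i \<and> (b' = 0 \<or> a' = n choose i) \<and>
           kk_bound n i a' + kk_bound n k b' \<le> kk_bound n i a + kk_bound n k b"
  using assms
proof (induction n arbitrary: i k a b)
  case 0
  show ?case
    by (rule exI[of _ "min (a + b) (0 choose i)"], rule exI[of _ "a + b - min (a + b) (0 choose i)"])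
      (use 0 in auto)
next
  case (Suc n)
  have max_b: ?case if "b = 0 \<or> a = Suc n choose i"
    by (rule exI[of _ a], rule exI[of _ b]) (use that Suc.prems in auto)
  consider "i = 0" | "k = Suc n" "0 < i" | i' k' where "i = Suc i'" "k = Suc k'" "k' < n"
    | "b = 0"
  proof (cases k)
    case 0
    then show ?thesis using that Suc.prems by auto
  next
    case (Suc k')
    then show ?thesis using that Suc.prems by (cases i; cases "k' < n"; cases "k' = n") (auto simp: binomial_eq_0)
  qed
  then show ?case
  proof cases
    \<comment> \<open>Level 0 holds only the empty set, whose shadow is empty, so filling it costs
      nothing.\<close>
    case 1
    show ?thesis
    proof (cases "a = 0 \<and> b > 0")
      case True
      show ?thesis
        by (rule exI[of _ 1], rule exI[of _ "b - 1"])
          (use True 1 Suc.prems kk_bound_mono[of "b - 1" b "Suc n" k] in auto)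
    next
      case False
      then show ?thesis using 1 Suc.prems by (intro max_b) auto
    qed
  next
    \<comment> \<open>The top level holds one set, and \<open>kk_bound_split\<close> fails there.
      Its contribution \<open>Suc n\<close> covers the cost of one more set on level
      \<open>i\<close>.\<close>
    case 2
    show ?thesis
    proof (cases "b = 0 \<or> a = Suc n choose i")
      case False
      then have b: "b = 1" and a: "a < Suc n choose i" using 2 Suc.prems by auto
      show ?thesis
        by (rule exI[of _ "Suc a"], rule exI[of _ 0])
          (use a b kk_bound_step[of a "Suc n" i] kk_bound_top[of "Suc n"] 2
            in \<open>auto simp del: kk_bound.simps binomial_Suc_Suc\<close>)
    qed (rule max_b)
  next
    case (3 i' k')
    have ordered: "\<exists>a' b'. a' + b' = a + b \<and> a \<le> a' \<and> a' \<le> Suc n choose i \<and>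
        (b' = 0 \<or> a' = Suc n choose i) \<and>
        kk_bound (Suc n) i a' + kk_bound (Suc n) k b' \<le> kk_bound (Suc n) i a + kk_bound (Suc n) k b"
      if ab: "a \<le> Suc n choose i" "b \<le> Suc n choose k" "i < k \<or> b \<le> a" for a b
    proof -
      \<comment> \<open>Both levels split into a part on \<open>{1..n}\<close> and a part containing \<open>n + 1\<close>. The moves
        \<open>b2 \<rightarrow> a1\<close>, \<open>b1 \<rightarrow> a1\<close>, \<open>b2 \<rightarrow> a2\<close>, \<open>b1 \<rightarrow> a2\<close>, in this order, keep the pieces initial
        segments. The first one goes up a level if \<open>i = k\<close>, but then \<open>b \<le> a\<close> makes it void.\<close>
      define a1 a2 b1 b2 where "a1 = min a (n choose i)" and "a2 = a - a1"
        and "b1 = min b (n choose k)" and "b2 = b - b1"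
      have a: "a = a1 + a2" "a1 \<le> n choose i" "a2 \<le> n choose i'" "a2 = 0 \<or> a1 = n choose i"
        using ab(1) 3 unfolding a1_def a2_def by auto
      have b: "b = b1 + b2" "b1 \<le> n choose k" "b2 \<le> n choose k'" "b2 = 0 \<or> b1 = n choose k"
        using ab(2) 3 unfolding b1_def b2_def by auto
      obtain c1 c2 where c: "c1 + c2 = a1 + b2" "a1 \<le> c1" "c1 \<le> n choose i"
        "c2 = 0 \<or> c1 = n choose i"
        "kk_bound n i c1 + kk_bound n k' c2 \<le> kk_bound n i a1 + kk_bound n k' b2"
      proof (cases "i < k")
        case True
        then have "i \<le> k'" using 3 by simp
        from Suc.IH[OF this a(2) b(3)] show ?thesis using that by blast
      next
        case False
        then have "b2 = 0 \<or> a1 = n choose i"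
          using ab(3) Suc.prems(1) b a unfolding a1_def b1_def b2_def by auto
        then show ?thesis using a by (intro that[of a1 b2]) auto
      qed
      obtain d1 d2 where d: "d1 + d2 = c1 + b1" "c1 \<le> d1" "d1 \<le> n choose i"
        "d2 = 0 \<or> d1 = n choose i"
        "kk_bound n i d1 + kk_bound n k d2 \<le> kk_bound n i c1 + kk_bound n k b1"
        using Suc.IH[OF Suc.prems(1) c(3) b(2)] by blast
      have "i' \<le> k'" "i' \<le> k" "c2 \<le> n choose k'" "d2 \<le> n choose k"
        using 3 Suc.prems(1) b(2,3) c(1,2) d(1,2) by auto
      note IH' = Suc.IH[OF this(1) a(3) this(3)] Suc.IH[OF this(2) _ this(4)]
      obtain e1 e2 where e: "e1 + e2 = a2 + c2" "a2 \<le> e1" "e1 \<le> n choose i'"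
        "e2 = 0 \<or> e1 = n choose i'"
        "kk_bound n i' e1 + kk_bound n k' e2 \<le> kk_bound n i' a2 + kk_bound n k' c2"
        using IH'(1) by blast
      obtain f1 f2 where f: "f1 + f2 = e1 + d2" "e1 \<le> f1" "f1 \<le> n choose i'"
        "f2 = 0 \<or> f1 = n choose i'"
        "kk_bound n i' f1 + kk_bound n k f2 \<le> kk_bound n i' e1 + kk_bound n k d2"
        using IH'(2)[OF e(3)] by blast
      note ar = a(1-4) b(1-4) c(1-4) d(1-4) e(1-4) f(1-4)
      \<comment> \<open>\<open>v1\<close> and \<open>v2\<close> say that \<open>d1, f1\<close> and
        \<open>f2, e2\<close> again form initial segments of levels \<open>i\<close> and
        \<open>k\<close>, as \<open>kk_bound_split\<close> requires; \<open>v3\<close> is the fill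
        condition of the goal.\<close>
      have v1: "f1 = 0 \<or> d1 = n choose i" using ar by linarith
      have v2: "e2 = 0 \<or> f2 = n choose k" using ar by linarith
      have v3: "f2 + e2 = 0 \<or> d1 + f1 = (n choose i') + (n choose i)" using ar by linarith
      have v4: "f2 \<le> n choose k" "d1 + f1 + (f2 + e2) = a + b" "a \<le> d1 + f1" using ar by linarith+
      have "i' < n" using 3 Suc.prems(1) by simp
      have s: "kk_bound (Suc n) i (d1 + f1) = kk_bound n i d1 + kk_bound n i' f1"
        "kk_bound (Suc n) i a = kk_bound n i a1 + kk_bound n i' a2"
        "kk_bound (Suc n) k (f2 + e2) = kk_bound n k f2 + kk_bound n k' e2"
        "kk_bound (Suc n) k b = kk_bound n k b1 + kk_bound n k' b2"
        using a(1,2,4) b(1,2,4) d(3) v1 v2 v4(1) 3 \<open>i' < n\<close> by (simp_all only: kk_bound_split)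
      show ?thesis
      proof (intro exI conjI)
        show "d1 + f1 + (f2 + e2) = a + b" "a \<le> d1 + f1" by (fact v4)+
        show "d1 + f1 \<le> Suc n choose i" using d(3) f(3) 3 by simp
        show "f2 + e2 = 0 \<or> d1 + f1 = Suc n choose i" using v3 3 by simp
        show "kk_bound (Suc n) i (d1 + f1) + kk_bound (Suc n) k (f2 + e2)
            \<le> kk_bound (Suc n) i a + kk_bound (Suc n) k b"
          unfolding s using c(5) d(5) e(5) f(5) by linarith
      qed
    qed
    show ?thesis
    proof (cases "i < k \<or> b \<le> a")
      case True
      then show ?thesis using ordered Suc.prems by blast
    next
      case False
      \<comment> \<open>On equal levels the two summands are interchangeable, so
        \<open>ordered\<close> applies with \<open>a\<close> and \<open>b\<close> swapped.\<close>
      then have "i = k" "a \<le> b" using Suc.prems by auto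
      moreover from this have "b \<le> Suc n choose i" "a \<le> Suc n choose k" "i < k \<or> a \<le> b"
        using Suc.prems(2,3) by auto
      from ordered[OF this] obtain a' b' where "a' + b' = b + a" "b \<le> a'" "a' \<le> Suc n choose i"
        "b' = 0 \<or> a' = Suc n choose i" "kk_bound (Suc n) i a' + kk_bound (Suc n) k b'
          \<le> kk_bound (Suc n) i b + kk_bound (Suc n) k a" by blast
      ultimately have "a' + b' = a + b \<and> a \<le> a' \<and> a' \<le> Suc n choose i \<and>
          (b' = 0 \<or> a' = Suc n choose i) \<and> kk_bound (Suc n) i a' + kk_bound (Suc n) k b'
            \<le> kk_bound (Suc n) i a + kk_bound (Suc n) k b"
        by (simp del: kk_bound.simps binomial_Suc_Suc)
      then show ?thesis by blast
    qed
  qed (use max_b in blast)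
qed

text \<open>Think of \<open>a\<close> sets avoiding \<open>n + 1\<close> and \<open>b\<close> sets
  containing it. Shadow sets without \<open>n + 1\<close> include the shadow of the first kind and
  the second kind with \<open>n + 1\<close> deleted, hence the \<open>max\<close>; the last term
  bounds the shadow sets with \<open>n + 1\<close>.\<close>

lemma kk_bound_eckhoff_wegner:
  assumes "a \<le> n choose Suc k" "b \<le> n choose k"
  shows "kk_bound (Suc n) (Suc k) (a + b) \<le> max (kk_bound n (Suc k) a) b + kk_bound n k b"
  using assms
proof (induction n arbitrary: k a b)
  case 0
  then show ?case by (cases k) auto
next
  case (Suc n)
  show ?case
  proof (cases k)
    case 0
    show ?thesis
    proof (cases "b = 0")
      case True
      then show ?thesis using Suc.prems by simp
    next
      case False
      have "kk_bound (Suc (Suc n)) (Suc k) (a + b) \<le> Suc (Suc n) choose k"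
        using Suc.prems by (intro kk_bound_le) simp
      then show ?thesis using False 0 by (simp del: kk_bound.simps)
    qed
  next
    case k: (Suc j)
    let ?M = "\<lambda>i. n choose i"
    define a2 b2 where "a2 = a - ?M (Suc k)" and "b2 = b - ?M k"
    have le: "a2 \<le> ?M k" "b2 \<le> ?M j" using Suc.prems k unfolding a2_def b2_def by auto
    consider "a \<le> ?M (Suc k)" "b \<le> ?M k" | "?M (Suc k) < a" "b \<le> ?M k"
      | "a \<le> ?M (Suc k)" "?M k < b" | "?M (Suc k) < a" "?M k < b" by linarith
    then show ?thesis
    proof cases
      case 1
      then show ?thesis using Suc.IH[of a k b] k by simp
    next
      case 2
      then have a: "a = ?M (Suc k) + a2" "0 < a2" unfolding a2_def by auto
      have Ka: "kk_bound (Suc n) (Suc k) a = ?M k + kk_bound n k a2" using a by simp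
      have Kb: "kk_bound (Suc n) k b = kk_bound n k b" using 2 k by simp
      have "j < n" by (rule ccontr) (use a le k in \<open>auto simp: binomial_eq_0\<close>)
      then have full: "kk_bound n k (?M k) = ?M j" using kk_bound_full[of j n] k by simp
      \<comment> \<open>\<open>a2\<close> and \<open>b\<close> both count sets of level
        \<open>k\<close> on \<open>{1..n}\<close>. Exchange on equal levels fills one block before
        starting the other, which is how the recursion splits \<open>a + b\<close>.\<close>
      obtain x y where xy: "x + y = a2 + b" "x \<le> ?M k" "y = 0 \<or> x = ?M k"
        "kk_bound n k x + kk_bound n k y \<le> kk_bound n k a2 + kk_bound n k b"
        using kk_bound_exchange[of k k a2 n b] le 2 by auto
      have "kk_bound (Suc (Suc n)) (Suc k) (a + b) = ?M k + kk_bound n k x + kk_bound n k y"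
      proof (cases "y = 0")
        case True
        then have "a + b = ?M (Suc k) + x" "0 < x" "x \<le> ?M k" using a xy by auto
        then show ?thesis using True by simp
      next
        case False
        then have "y \<le> ?M k" "x = ?M k" using xy le 2 by auto
        moreover from this have "a + b = ?M (Suc k) + ?M k + y" using a xy by simp
        ultimately show ?thesis using False full k by simp
      qed
      then show ?thesis using xy Ka Kb by simp
    next
      case 3
      have b: "b = ?M k + b2" "0 < b2" using 3 unfolding b2_def by auto
      have Kb: "kk_bound (Suc n) k b = ?M j + kk_bound n j b2" using b k by simp
      \<comment> \<open>The \<open>max\<close> is bounded below by \<open>b\<close> alone, so
        \<open>a\<close> may be raised to \<open>n choose Suc k\<close>; the excess
        \<open>b2\<close> is then handled by the induction hypothesis with 0 as first part.\<close>
      have "kk_bound (Suc (Suc n)) (Suc k) (a + b)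
          \<le> kk_bound (Suc (Suc n)) (Suc k) ((Suc n choose Suc k) + b2)"
        by (rule kk_bound_mono) (use 3 b le k in auto)
      also have "\<dots> = (Suc n choose k) + kk_bound (Suc n) k b2"
        using b by (simp del: binomial_Suc_Suc)
      also have "kk_bound (Suc n) k b2 \<le> b2 + kk_bound n j b2"
        using Suc.IH[of 0 j b2] le k by simp
      finally show ?thesis using Kb b k by (simp del: kk_bound.simps)
    next
      case 4
      have a: "a = ?M (Suc k) + a2" "0 < a2" using 4 unfolding a2_def by auto
      have b: "b = ?M k + b2" "0 < b2" using 4 unfolding b2_def by auto
      have Ka: "kk_bound (Suc n) (Suc k) a = ?M k + kk_bound n k a2" using a by simp
      have Kb: "kk_bound (Suc n) k b = ?M j + kk_bound n j b2" using b k by simp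
      have sum: "a + b = (Suc n choose Suc k) + (a2 + b2)" using a b by simp
      have "kk_bound (Suc (Suc n)) (Suc k) (a + b)
          = (Suc n choose k) + kk_bound (Suc n) k (a2 + b2)"
        unfolding sum using a(2) by (simp del: binomial_Suc_Suc)
      \<comment> \<open>Both arguments of the \<open>max\<close> exceed those for \<open>a2\<close>
        and \<open>b2\<close> by \<open>n choose k\<close>, so this term comes out of the
        \<open>max\<close>.\<close>
      also have "kk_bound (Suc n) k (a2 + b2) \<le> max (kk_bound n k a2) b2 + kk_bound n j b2"
        using Suc.IH[of a2 j b2] le k by simp
      finally show ?thesis using Ka Kb b k by (simp del: kk_bound.simps)
    qed
  qed
qed

section \<open>Filling the levels from the bottom\<close>

lemma kk_bound_sum_greedy:
  assumes "\<forall>i\<le>n. d i \<le> n choose i"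
  shows "\<exists>g. (\<forall>i\<le>n. g i \<le> n choose i) \<and> (\<Sum>i\<le>n. g i) = (\<Sum>i\<le>n. d i) \<and>
           (\<forall>i j. i < j \<longrightarrow> j \<le> n \<longrightarrow> g i = n choose i \<or> g j = 0) \<and>
           (\<Sum>i\<le>n. kk_bound n i (g i)) \<le> (\<Sum>i\<le>n. kk_bound n i (d i))"
  using assms
\<comment> \<open>An exchange between a level that is not full and a higher nonempty one moves sets
  downwards, so the total size of all sets drops.\<close>
proof (induction "\<Sum>i\<le>n. i * d i" arbitrary: d rule: less_induct)
  case less
  show ?case
  proof (cases "\<forall>i j. i < j \<longrightarrow> j \<le> n \<longrightarrow> d i = n choose i \<or> d j = 0")
    case True
    then show ?thesis using less.prems by (intro exI[of _ d]) auto
  next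
    case False
    then obtain i j where ij: "i < j" "j \<le> n" "d i \<noteq> n choose i" "d j \<noteq> 0" by blast
    obtain a b where ab: "a + b = d i + d j" "d i \<le> a" "a \<le> n choose i" "b = 0 \<or> a = n choose i"
      "kk_bound n i a + kk_bound n j b \<le> kk_bound n i (d i) + kk_bound n j (d j)"
      using kk_bound_exchange[of i j "d i" n "d j"] ij less.prems by auto
    define e where "e = d(i := a, j := b)"
    \<comment> \<open>Additive form of the change in a levelwise sum, free of truncated subtraction;
      used for the measure, the total count and the shadow bound.\<close>
    have upd: "(\<Sum>l\<le>n. h l (e l)) + (h i (d i) + h j (d j)) = (\<Sum>l\<le>n. h l (d l)) + (h i a + h j b)"
      for h :: "nat \<Rightarrow> nat \<Rightarrow> nat"
    proof -
      let ?R = "{..n} - {i, j}"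
      have ins: "{..n} = insert i (insert j ?R)" using ij by auto
      have "(\<Sum>l\<le>n. h l (f l)) = h i (f i) + (h j (f j) + (\<Sum>l\<in>?R. h l (f l)))" for f
        using ij(1) by (subst ins) simp
      moreover have "(\<Sum>l\<in>?R. h l (e l)) = (\<Sum>l\<in>?R. h l (d l))"
        by (rule sum.cong) (auto simp: e_def)
      ultimately show ?thesis using ij(1) by (simp add: e_def)
    qed
    obtain t where t: "a = d i + t" using ab(2) le_Suc_ex by blast
    then have t': "d j = b + t" using ab(1) by simp
    have "t \<noteq> 0" using t t' ab(4) ij by auto
    then have "i * t < j * t" using ij by simp
    then have "i * a + j * b < i * d i + j * d j" using t t' by (simp add: algebra_simps)
    then have meas: "(\<Sum>l\<le>n. l * e l) < (\<Sum>l\<le>n. l * d l)"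
      using upd[of "\<lambda>l x. l * x"] by linarith
    have "b \<le> n choose j" using t' less.prems ij by (metis le_add1 order_trans)
    then have "\<forall>l\<le>n. e l \<le> n choose l" using less.prems ab(3) by (simp add: e_def)
    from less.hyps[OF meas this] obtain g where g: "\<forall>i\<le>n. g i \<le> n choose i"
      "(\<Sum>i\<le>n. g i) = (\<Sum>i\<le>n. e i)" "\<forall>i j. i < j \<longrightarrow> j \<le> n \<longrightarrow> g i = n choose i \<or> g j = 0"
      "(\<Sum>i\<le>n. kk_bound n i (g i)) \<le> (\<Sum>i\<le>n. kk_bound n i (e i))" by blast
    moreover have "(\<Sum>i\<le>n. e i) = (\<Sum>i\<le>n. d i)" using upd[of "\<lambda>l x. x"] ab(1) by linarith
    moreover have "(\<Sum>i\<le>n. kk_bound n i (e i)) \<le> (\<Sum>i\<le>n. kk_bound n i (d i))"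
      using upd[of "kk_bound n"] ab(5) by linarith
    ultimately show ?thesis by (intro exI[of _ g]) auto
  qed
qed

text \<open>At the first index where the functions differ, the smaller one is not full, so it
  vanishes beyond and has the smaller sum.\<close>

lemma greedy_unique:
  fixes c g h :: "nat \<Rightarrow> nat"
  assumes "\<forall>i\<le>n. g i \<le> c i" "\<forall>i\<le>n. h i \<le> c i" "(\<Sum>i\<le>n. g i) = (\<Sum>i\<le>n. h i)"
    and "\<forall>i j. i < j \<longrightarrow> j \<le> n \<longrightarrow> g i = c i \<or> g j = 0"
    and "\<forall>i j. i < j \<longrightarrow> j \<le> n \<longrightarrow> h i = c i \<or> h j = 0"
    and "i \<le> n"
  shows "g i = h i"
proof -
  have not_less: "\<not> g i < h i"
    if "\<forall>i\<le>n. h i \<le> c i" "(\<Sum>i\<le>n. g i) = (\<Sum>i\<le>n. h i)"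
      "\<forall>i j. i < j \<longrightarrow> j \<le> n \<longrightarrow> g i = c i \<or> g j = 0"
      "i \<le> n" "\<forall>j<i. g j = h j" for g h i
  proof
    assume less: "g i < h i"
    then have "g i \<noteq> c i" using that(1,4) by (metis leD)
    then have "g j = 0" if "i < j" "j \<le> n" for j
      using that \<open>\<forall>i j. i < j \<longrightarrow> j \<le> n \<longrightarrow> g i = c i \<or> g j = 0\<close> by blast
    then have "g j \<le> h j" if "j \<le> n" for j
      using less that \<open>\<forall>j<i. g j = h j\<close> by (cases j i rule: linorder_cases) auto
    then have "(\<Sum>i\<le>n. g i) < (\<Sum>i\<le>n. h i)"
      using less \<open>i \<le> n\<close> by (intro sum_strict_mono_ex1) auto
    then show False using that(2) by simp
  qed
  show ?thesis using assms(6)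
  proof (induction i rule: less_induct)
    case (less i)
    then have "\<forall>j<i. g j = h j" "\<forall>j<i. h j = g j" by auto
    then have "\<not> g i < h i" "\<not> h i < g i"
      using not_less[of h g i] not_less[of g h i] assms less.prems by simp_all
    then show ?case by simp
  qed
qed

section \<open>Shadows\<close>

definition level :: "nat \<Rightarrow> nat \<Rightarrow> nat set set" where
  "level n k = {S. S \<subseteq> {1..n} \<and> card S = k}"

definition shadow :: "'a set set \<Rightarrow> 'a set set" where
  "shadow F = {S - {x} | S x. S \<in> F \<and> x \<in> S}"

lemma card_level: "card (level n k) = n choose k"
  unfolding level_def using n_subsets[of "{1..n}" k] by simp

lemma finite_level [simp]: "finite (level n k)"
  unfolding level_def by simp

lemma shadow_level: "F \<subseteq> level n (Suc k) \<Longrightarrow> shadow F \<subseteq> level n k"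
  unfolding shadow_def level_def by (auto simp: card_Diff_singleton_if)

lemma shadow_level_0: "F \<subseteq> level n 0 \<Longrightarrow> shadow F = {}"
proof -
  have "level n 0 = {{}}" unfolding level_def by (auto dest: finite_subset)
  then show "F \<subseteq> level n 0 \<Longrightarrow> shadow F = {}" unfolding shadow_def by blast
qed

section \<open>Splitting a level by membership of the largest element\<close>

lemma level_Suc_notin: "S \<in> level n k \<Longrightarrow> Suc n \<notin> S"
  unfolding level_def by auto

lemma insert_in_level_Suc: "S \<in> level n k \<Longrightarrow> insert (Suc n) S \<in> level (Suc n) (Suc k)"
  using level_Suc_notin[of S n k] finite_subset[of S "{1..n}"]
  unfolding level_def by auto

lemma level_Suc_cases:
  assumes "S \<in> level (Suc n) (Suc k)"
  obtains "Suc n \<notin> S" "S \<in> level n (Suc k)"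
  | T where "S = insert (Suc n) T" "T \<in> level n k"
proof (cases "Suc n \<in> S")
  case True
  have "S - {Suc n} \<in> level n k"
    using assms True unfolding level_def by (auto simp: card_Diff_singleton_if)
  then show ?thesis using True that(2)[of "S - {Suc n}"] by (simp add: insert_absorb)
next
  case False
  then have "S \<in> level n (Suc k)" using assms unfolding level_def by (auto simp: le_Suc_eq)
  then show ?thesis using False that(1) by blast
qed

lemma inj_on_insert_new: "\<forall>S\<in>F. x \<notin> S \<Longrightarrow> inj_on (insert x) F"
  by (rule inj_onI) (metis insert_ident)

lemma card_level_Suc_split:
  assumes "F0 \<subseteq> level n i" "F1 \<subseteq> level n j"
  shows "card (F0 \<union> insert (Suc n) ` F1) = card F0 + card F1"
proof -
  have "inj_on (insert (Suc n)) F1"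
    using assms level_Suc_notin by (intro inj_on_insert_new) blast
  moreover have "F0 \<inter> insert (Suc n) ` F1 = {}" using assms level_Suc_notin by blast
  moreover have "finite F0" "finite F1" using assms finite_level finite_subset by blast+
  ultimately show ?thesis by (simp add: card_Un_disjoint card_image)
qed

lemma level_Suc_split:
  assumes "F \<subseteq> level (Suc n) (Suc k)"
  defines "F0 \<equiv> F \<inter> level n (Suc k)" and "F1 \<equiv> {T \<in> level n k. insert (Suc n) T \<in> F}"
  shows "F = F0 \<union> insert (Suc n) ` F1"
proof
  show "F \<subseteq> F0 \<union> insert (Suc n) ` F1"
  proof
    fix S assume "S \<in> F"
    then have "S \<in> level (Suc n) (Suc k)" using assms by blast
    then show "S \<in> F0 \<union> insert (Suc n) ` F1"
      by (cases rule: level_Suc_cases) (use \<open>S \<in> F\<close> in \<open>auto simp: F0_def F1_def\<close>)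
  qed
qed (auto simp: F0_def F1_def)

lemma shadow_Un: "shadow (F \<union> G) = shadow F \<union> shadow G"
  unfolding shadow_def by blast

text \<open>Deleting \<open>x\<close> gives back \<open>F\<close>; deleting any other element
  commutes with inserting \<open>x\<close>.\<close>

lemma shadow_insert_image:
  assumes "\<forall>S\<in>F. x \<notin> S"
  shows "shadow (insert x ` F) = F \<union> insert x ` shadow F"
proof (intro subset_antisym subsetI)
  fix T assume "T \<in> shadow (insert x ` F)"
  then obtain S y where S: "S \<in> F" "y \<in> insert x S" "T = insert x S - {y}"
    unfolding shadow_def by blast
  show "T \<in> F \<union> insert x ` shadow F"
  proof (cases "y = x")
    case True
    then show ?thesis using S assms by (simp add: Diff_insert_absorb)
  next
    case False
    then have "T = insert x (S - {y})" "y \<in> S" using S by auto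
    then show ?thesis using S(1) unfolding shadow_def by blast
  qed
next
  fix T assume "T \<in> F \<union> insert x ` shadow F"
  then consider "T \<in> F" | S y where "S \<in> F" "y \<in> S" "T = insert x (S - {y})"
    unfolding shadow_def by blast
  then show "T \<in> shadow (insert x ` F)"
  proof cases
    case 1
    then have "T = insert x T - {x}" using assms by auto
    then show ?thesis using 1 unfolding shadow_def by blast
  next
    case 2
    then have "T = insert x S - {y}" using assms by auto
    then show ?thesis using 2 unfolding shadow_def by blast
  qed
qed

lemma shadow_level_Suc_split:
  assumes "F1 \<subseteq> level n j"
  shows "shadow (F0 \<union> insert (Suc n) ` F1) = (shadow F0 \<union> F1) \<union> insert (Suc n) ` shadow F1"
proof -
  have "\<forall>S\<in>F1. Suc n \<notin> S" using assms level_Suc_notin by blast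
  then show ?thesis by (simp only: shadow_Un shadow_insert_image Un_assoc)
qed

text \<open>After the split by \<open>n + 1\<close>, the shadow sets without \<open>n + 1\<close>
  are \<open>shadow F0\<close> together with \<open>F1\<close>, hence at least as many as either;
  those with \<open>n + 1\<close> correspond to \<open>shadow F1\<close>.
  \<open>kk_bound_eckhoff_wegner\<close> combines the two counts.\<close>

theorem kruskal_katona:
  assumes "F \<subseteq> level n k"
  shows "kk_bound n k (card F) \<le> card (shadow F)"
  using assms
proof (induction n arbitrary: k F)
  case (Suc n)
  show ?case
  proof (cases k)
    case k: (Suc j)
    define F0 F1 where "F0 = F \<inter> level n (Suc j)"
      and "F1 = {T \<in> level n j. insert (Suc n) T \<in> F}"
    have sub: "F0 \<subseteq> level n (Suc j)" "F1 \<subseteq> level n j" unfolding F0_def F1_def by auto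
    have F: "F = F0 \<union> insert (Suc n) ` F1"
      using level_Suc_split[of F n j] Suc.prems k unfolding F0_def F1_def by simp
    have sh0: "shadow F0 \<subseteq> level n j" by (rule shadow_level[OF sub(1)])
    have fin: "finite (shadow F0 \<union> F1)" using sh0 sub finite_subset[OF _ finite_level] by blast
    have sh: "shadow F = (shadow F0 \<union> F1) \<union> insert (Suc n) ` shadow F1"
      by (subst F) (rule shadow_level_Suc_split[OF sub(2)])
    have card_sh: "card (shadow F) = card (shadow F0 \<union> F1) + card (shadow F1)"
    proof (cases j)
      case 0
      then show ?thesis using sh shadow_level_0 sub by simp
    next
      case (Suc i)
      then show ?thesis unfolding sh
        using sub sh0 shadow_level[of F1 n i] by (intro card_level_Suc_split) auto
    qed
    have "card F0 \<le> n choose Suc j" "card F1 \<le> n choose j"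
      using card_mono[OF finite_level sub(1)] card_mono[OF finite_level sub(2)]
      by (simp_all add: card_level)
    then have "kk_bound (Suc n) (Suc j) (card F0 + card F1)
        \<le> max (kk_bound n (Suc j) (card F0)) (card F1) + kk_bound n j (card F1)"
      by (rule kk_bound_eckhoff_wegner)
    also have "\<dots> \<le> card (shadow F0 \<union> F1) + card (shadow F1)"
      using Suc.IH[OF sub(1)] Suc.IH[OF sub(2)] card_mono[OF fin, of "shadow F0"]
        card_mono[OF fin, of F1] by (intro add_mono) auto
    also have "\<dots> = card (shadow F)" by (rule card_sh[symmetric])
    also have "card F0 + card F1 = card F"
      by (subst F, subst card_level_Suc_split[OF sub]) simp
    finally show ?thesis using k by simp
  qed simp
qed simp

text \<open>In colex every set with \<open>n + 1\<close> follows all sets of its size without it. So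
  either \<open>F1\<close> is empty or \<open>F0\<close> is a full level, matching the two branches
  of \<open>kk_bound\<close>.\<close>

lemma card_shadow_colex_initial:
  assumes "F \<subseteq> level n k" "\<forall>B\<in>F. \<forall>A\<in>level n k. level_colex_less A B \<longrightarrow> A \<in> F"
  shows "card (shadow F) \<le> kk_bound n k (card F)"
  using assms
proof (induction n arbitrary: k F)
  case 0
  have "F \<subseteq> level 0 0" using 0 unfolding level_def by auto
  then show ?case using shadow_level_0[of F 0] by simp
next
  case (Suc n)
  show ?case
  proof (cases k)
    case 0
    then show ?thesis using shadow_level_0[of F] Suc.prems by simp
  next
    case k: (Suc j)
    define F0 F1 where "F0 = F \<inter> level n (Suc j)"
      and "F1 = {T \<in> level n j. insert (Suc n) T \<in> F}"
    have sub: "F0 \<subseteq> level n (Suc j)" "F1 \<subseteq> level n j" unfolding F0_def F1_def by auto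
    have F: "F = F0 \<union> insert (Suc n) ` F1"
      using level_Suc_split[of F n j] Suc.prems k unfolding F0_def F1_def by simp
    have lev: "level n (Suc j) \<subseteq> level (Suc n) k" using k unfolding level_def by auto
    have card_F: "card F = card F0 + card F1"
      by (subst F, subst card_level_Suc_split[OF sub]) simp
    have fin: "finite A" if "A \<in> level m i" for A m i
      using that finite_subset unfolding level_def by auto
    show ?thesis
    proof (cases "F1 = {}")
      case True
      then have "F = F0" using F by simp
      moreover have "card F0 \<le> n choose Suc j"
        using card_mono[OF finite_level sub(1)] by (simp add: card_level)
      moreover have "card (shadow F0) \<le> kk_bound n (Suc j) (card F0)"
        using sub(1) Suc.prems(2) lev \<open>F = F0\<close> by (intro Suc.IH) blast+
      ultimately show ?thesis using k by simp
    next
      case False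
      then obtain T where T: "T \<in> level n j" "insert (Suc n) T \<in> F" unfolding F1_def by blast
      have "A \<in> F" if A: "A \<in> level n (Suc j)" for A
      proof -
        have "finite A" "finite (insert (Suc n) T)" using A T(1) fin by auto
        moreover have "\<forall>k>Suc n. k \<in> A \<longleftrightarrow> k \<in> insert (Suc n) T"
          using A T(1) unfolding level_def by auto
        ultimately have "A \<noteq> insert (Suc n) T \<and>
            Max (sym_diff A (insert (Suc n) T)) \<in> insert (Suc n) T"
          using Max_sym_diff_iff[of A "insert (Suc n) T"] level_Suc_notin[OF A] by blast
        moreover have "card A = card (insert (Suc n) T)"
          using A insert_in_level_Suc[OF T(1)] unfolding level_def by auto
        ultimately have "level_colex_less A (insert (Suc n) T)"
          unfolding level_colex_less_def by blast
        then show "A \<in> F" using Suc.prems(2) T(2) A lev by blast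
      qed
      then have F0: "F0 = level n (Suc j)" unfolding F0_def by blast
      have "card (shadow F1) \<le> kk_bound n j (card F1)"
      proof (rule Suc.IH[OF sub(2)], intro ballI impI)
        fix B A assume BA: "B \<in> F1" "A \<in> level n j" "level_colex_less A B"
        have B: "B \<in> level n j" "insert (Suc n) B \<in> F" using BA(1) unfolding F1_def by auto
        have nin: "Suc n \<notin> A" "Suc n \<notin> B" using BA(2) B(1) level_Suc_notin by blast+
        \<comment> \<open>Adding \<open>n + 1\<close> to both sets preserves colex order, so
          \<open>F1\<close> is again initial.\<close>
        then have "sym_diff (insert (Suc n) A) (insert (Suc n) B) = sym_diff A B" by auto
        moreover have "insert (Suc n) A \<noteq> insert (Suc n) B" if "A \<noteq> B"
          using nin that by (metis insert_ident)
        moreover have "card A = card B" using BA(2) B(1) unfolding level_def by simp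
        ultimately have "level_colex_less (insert (Suc n) A) (insert (Suc n) B)"
          using BA(3) nin fin[OF BA(2)] fin[OF B(1)] unfolding level_colex_less_def by auto
        then show "A \<in> F1"
          using Suc.prems(2) B(2) insert_in_level_Suc[OF BA(2)] BA(2) k unfolding F1_def by blast
      qed
      moreover have "card (shadow F) \<le> (n choose j) + card (shadow F1)"
      proof -
        have "shadow F = (shadow F0 \<union> F1) \<union> insert (Suc n) ` shadow F1"
          by (subst F) (rule shadow_level_Suc_split[OF sub(2)])
        also have "\<dots> \<subseteq> level n j \<union> insert (Suc n) ` shadow F1"
          using shadow_level[OF sub(1)] sub(2) by blast
        finally have "shadow F \<subseteq> level n j \<union> insert (Suc n) ` shadow F1" .
        moreover have "finite (shadow F1)"
          using shadow_level_0[of F1 n] finite_subset[OF shadow_level finite_level, of F1 n] sub(2)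
          by (cases j) auto
        ultimately have "card (shadow F) \<le> card (level n j \<union> insert (Suc n) ` shadow F1)"
          by (intro card_mono) auto
        also have "\<dots> \<le> card (level n j) + card (insert (Suc n) ` shadow F1)" by (rule card_Un_le)
        also have "\<dots> \<le> (n choose j) + card (shadow F1)"
          using card_image_le[OF \<open>finite (shadow F1)\<close>, of "insert (Suc n)"] by (simp add: card_level)
        finally show ?thesis .
      qed
      moreover have "0 < card F1"
        using False finite_subset[OF sub(2) finite_level] by (simp add: card_gt_0_iff)
      moreover have "card F = (n choose Suc j) + card F1" using card_F F0 by (simp add: card_level)
      ultimately show ?thesis using k by simp
    qed
  qed
qed

section \<open>Counting families and shadows level by level\<close>

lemma boolean_lattice_levels: "boolean_lattice n = (\<Union>k\<le>n. level n k)"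
proof -
  have "card S \<le> n" if "S \<subseteq> {1..n}" for S :: "nat set"
    using card_mono[OF _ that] by simp
  then show ?thesis unfolding boolean_lattice_def level_def by auto
qed

lemma card_eq_sum_levels:
  assumes "F \<subseteq> boolean_lattice n"
  shows "card F = (\<Sum>k\<le>n. card (F \<inter> level n k))"
proof -
  have "F = (\<Union>k\<le>n. F \<inter> level n k)" using assms boolean_lattice_levels by auto
  also have "card \<dots> = (\<Sum>k\<le>n. card (F \<inter> level n k))"
    by (rule card_UN_disjoint) (auto simp: level_def)
  finally show ?thesis .
qed

lemma card_shadow_eq_sum_levels:
  assumes "F \<subseteq> boolean_lattice n"
  shows "card (shadow F) = (\<Sum>k\<le>n. card (shadow (F \<inter> level n k)))"
proof -
  have "F = (\<Union>k\<le>n. F \<inter> level n k)" using assms boolean_lattice_levels by auto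
  moreover have "shadow (\<Union>k\<le>n. F \<inter> level n k) = (\<Union>k\<le>n. shadow (F \<inter> level n k))"
    unfolding shadow_def by blast
  ultimately have "card (shadow F) = card (\<Union>k\<le>n. shadow (F \<inter> level n k))" by metis
  also have "\<dots> = (\<Sum>k\<le>n. card (shadow (F \<inter> level n k)))"
  proof (rule card_UN_disjoint)
    \<comment> \<open>With \<open>card T = k - 1\<close> instead of \<open>Suc\<close>, truncation
      would fail to separate the shadows of levels 0 and 1.\<close>
    have card_sh: "Suc (card T) = k \<and> T \<subseteq> {1..n}" if "T \<in> shadow (F \<inter> level n k)" for T k
    proof -
      obtain S x where "S \<subseteq> {1..n}" "card S = k" "x \<in> S" "T = S - {x}"
        using \<open>T \<in> _\<close> unfolding shadow_def level_def by blast
      moreover from this have "finite S" using finite_subset by blast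
      ultimately show ?thesis using card_Suc_Diff1[of S x] by auto
    qed
    have "shadow (F \<inter> level n k) \<subseteq> Pow {1..n}" for k using card_sh by blast
    then show "\<forall>k\<in>{..n}. finite (shadow (F \<inter> level n k))"
      by (meson finite_Pow_iff finite_atLeastAtMost finite_subset)
    show "\<forall>i\<in>{..n}. \<forall>j\<in>{..n}. i \<noteq> j \<longrightarrow>
        shadow (F \<inter> level n i) \<inter> shadow (F \<inter> level n j) = {}"
      using card_sh by blast
  qed simp
  finally show ?thesis .
qed

section \<open>Width of downsets\<close>

lemma width_ge:
  assumes "finite F" "X \<subseteq> F" "antichain X"
  shows "card X \<le> width F"
  unfolding width_def using assms by (intro Max_ge) auto

lemma width_attained:
  assumes "finite F"
  obtains X where "X \<subseteq> F" "antichain X" "card X = width F"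
proof -
  have "antichain ({} :: 'a set set)" unfolding antichain_def by simp
  then have "width F \<in> card ` {X. X \<subseteq> F \<and> antichain X}"
    unfolding width_def using assms by (intro Max_in) auto
  then show ?thesis using that by auto
qed

lemma shadow_downset_subset: "downset D \<Longrightarrow> shadow D \<subseteq> D"
  unfolding downset_def shadow_def by blast

text \<open>Below any proper superset in \<open>D\<close>, the downset contains a superset with just
  one more element, so deleting single elements reaches every non-maximal member.\<close>

lemma antichain_minus_shadow:
  assumes "downset D"
  shows "antichain (D - shadow D)"
proof -
  have "\<not> S \<subset> T" if "S \<in> D - shadow D" "T \<in> D" for S T
  proof
    assume "S \<subset> T"
    then obtain x where x: "x \<in> T" "x \<notin> S" by blast
    then have "insert x S \<in> D" using \<open>S \<subset> T\<close> \<open>T \<in> D\<close> assms unfolding downset_def by blast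
    moreover have "S = insert x S - {x}" using x by auto
    ultimately have "S \<in> shadow D" unfolding shadow_def by blast
    then show False using that by blast
  qed
  then show ?thesis unfolding antichain_def pairwise_def by blast
qed

section \<open>Initial segments of level-colex and their shadows\<close>

lemma downset_level_colex_first: "downset (level_colex_first n m)"
  unfolding downset_def
proof (intro allI impI)
  fix X Y assume X: "X \<in> level_colex_first n m" "Y \<subseteq> X"
  then have bl: "X \<in> boolean_lattice n" "Y \<in> boolean_lattice n"
    unfolding level_colex_first_def boolean_lattice_def by auto
  show "Y \<in> level_colex_first n m"
  proof (cases "Y = X")
    case False
    then have "card Y < card X" using X(2) bl(1) boolean_lattice_finite
      by (metis psubset_card_mono psubsetI)
    then show ?thesis using level_colex_first_closed[OF X(1) bl(2)]
      unfolding level_colex_less_def by blast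
  qed (use X in simp)
qed

text \<open>Size is compared first, so one set of level \<open>j\<close> brings in all of level
  \<open>i\<close>. This is the fill condition for \<open>greedy_unique\<close>.\<close>

lemma level_colex_first_greedy:
  assumes "i < j"
  shows "card (level_colex_first n m \<inter> level n i) = n choose i \<or>
    card (level_colex_first n m \<inter> level n j) = 0"
proof (cases "level_colex_first n m \<inter> level n j = {}")
  case False
  then obtain B where B: "B \<in> level_colex_first n m" "B \<in> level n j" by blast
  have "A \<in> level_colex_first n m" if "A \<in> level n i" for A
    using level_colex_first_closed[OF B(1), of A] B(2) that assms
    unfolding level_def boolean_lattice_def level_colex_less_def by auto
  then have "level_colex_first n m \<inter> level n i = level n i" by blast
  then show ?thesis by (simp add: card_level)
qed simp

lemma card_shadow_level_colex_first:
  "card (shadow (level_colex_first n m))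
     \<le> (\<Sum>k\<le>n. kk_bound n k (card (level_colex_first n m \<inter> level n k)))"
proof -
  have "level_colex_first n m \<subseteq> boolean_lattice n" unfolding level_colex_first_def by blast
  moreover have "card (shadow (level_colex_first n m \<inter> level n k))
      \<le> kk_bound n k (card (level_colex_first n m \<inter> level n k))" for k
    by (rule card_shadow_colex_initial)
      (auto intro: level_colex_first_closed simp: level_def boolean_lattice_def)
  ultimately show ?thesis by (simp add: card_shadow_eq_sum_levels sum_mono)
qed

lemma card_shadow_level_colex_first_le:
  assumes "D \<subseteq> boolean_lattice n"
  shows "card (shadow (level_colex_first n (card D))) \<le> card (shadow D)"
proof -
  let ?I = "level_colex_first n (card D)"
  have card_le: "card (F \<inter> level n k) \<le> n choose k" for F k
    using card_mono[OF finite_level, of "F \<inter> level n k" n k] by (simp add: card_level)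
  then obtain g where g: "\<forall>i\<le>n. g i \<le> n choose i"
    "(\<Sum>i\<le>n. g i) = (\<Sum>i\<le>n. card (D \<inter> level n i))"
    "\<forall>i j. i < j \<longrightarrow> j \<le> n \<longrightarrow> g i = n choose i \<or> g j = 0"
    "(\<Sum>i\<le>n. kk_bound n i (g i)) \<le> (\<Sum>i\<le>n. kk_bound n i (card (D \<inter> level n i)))"
    using kk_bound_sum_greedy[of n "\<lambda>i. card (D \<inter> level n i)"] by auto
  have "?I \<subseteq> boolean_lattice n" unfolding level_colex_first_def by blast
  moreover have "card ?I = card D"
    using assms by (intro card_level_colex_first card_mono) auto
  ultimately have "(\<Sum>i\<le>n. g i) = (\<Sum>i\<le>n. card (?I \<inter> level n i))"
    using g(2) card_eq_sum_levels[OF assms] card_eq_sum_levels[of ?I n] by simp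
  \<comment> \<open>Uniqueness identifies the abstract result of the exchanges with the level sizes
    of the actual initial segment.\<close>
  then have gI: "g i = card (?I \<inter> level n i)" if "i \<le> n" for i
    by (intro greedy_unique[of n g "\<lambda>i. n choose i" "\<lambda>i. card (?I \<inter> level n i)" i]
        g(1,3) that allI impI card_le level_colex_first_greedy)
  have "card (shadow ?I) \<le> (\<Sum>i\<le>n. kk_bound n i (g i))"
    using gI card_shadow_level_colex_first[of n "card D"] by simp
  also have "\<dots> \<le> (\<Sum>i\<le>n. kk_bound n i (card (D \<inter> level n i)))" by (rule g(4))
  also have "\<dots> \<le> (\<Sum>i\<le>n. card (shadow (D \<inter> level n i)))"
    by (intro sum_mono kruskal_katona) blast
  also have "\<dots> = card (shadow D)" by (rule card_shadow_eq_sum_levels[OF assms, symmetric])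
  finally show ?thesis .
qed

theorem theorem3:
  fixes n :: nat and A :: "nat set set"
  assumes "A \<subseteq> boolean_lattice n" and "downset A"
  shows "width A \<le> width (level_colex_first n (card A))"
proof -
  have finA: "finite A" using assms(1) finite_subset finite_boolean_lattice by blast
  then obtain X where X: "X \<subseteq> A" "antichain X" "card X = width A" by (rule width_attained)
  \<comment> \<open>Passing from \<open>A\<close> to the downset generated by \<open>X\<close> makes
    \<open>X\<close> avoid the shadow, so that \<open>card X\<close> is at most
    \<open>card D - card (shadow D)\<close>.\<close>
  define D where "D = (\<Union>S\<in>X. Pow S)"
  have D: "X \<subseteq> D" "D \<subseteq> A" "downset D"
    using X(1) assms(2) unfolding D_def downset_def by blast+
  have finD: "finite D" using D(2) finA finite_subset by blast
  have "X \<inter> shadow D = {}"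
  proof -
    have False if S: "S \<in> X" "T \<in> X" "U \<subseteq> T" "x \<in> U" "S = U - {x}" for S T U x
    proof -
      have "S \<subseteq> T" "x \<in> T" "x \<notin> S" using S(3-5) by blast+
      then show False using X(2) S(1,2) unfolding antichain_def pairwise_def by metis
    qed
    then show ?thesis unfolding shadow_def D_def by blast
  qed
  then have "X \<subseteq> D - shadow D" using D(1) by blast
  then have "card X \<le> card (D - shadow D)" using finD by (intro card_mono) auto
  also have "\<dots> = card D - card (shadow D)"
    using shadow_downset_subset[OF D(3)] finD by (intro card_Diff_subset) (rule finite_subset)
  also have "\<dots> \<le> card D - card (shadow (level_colex_first n (card D)))"
    by (rule diff_le_mono2, rule card_shadow_level_colex_first_le) (use D(2) assms(1) in blast)
  also have "\<dots> \<le> width (level_colex_first n (card A))"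
  proof -
    let ?I = "level_colex_first n (card D)"
    have "card D \<le> card A" using D(2) finA by (rule card_mono[rotated])
    then have sub: "?I \<subseteq> level_colex_first n (card A)" unfolding level_colex_first_def by auto
    have fin: "finite (level_colex_first n m)" for m unfolding level_colex_first_def by simp
    have "card ?I = card D"
      using D(2) assms(1) by (intro card_level_colex_first card_mono) auto
    \<comment> \<open>The shadow lies inside the segment, so the subtraction is exact and counts the
      maximal elements of \<open>?I\<close>, an antichain in the possibly longer segment for
      \<open>card A\<close>.\<close>
    then have "card D - card (shadow ?I) = card (?I - shadow ?I)"
      using card_Diff_subset[of "shadow ?I" ?I] finite_subset[OF _ fin]
        shadow_downset_subset[OF downset_level_colex_first] by simp
    also have "\<dots> \<le> width (level_colex_first n (card A))"
      using sub by (intro width_ge fin antichain_minus_shadow downset_level_colex_first) blast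
    finally show ?thesis .
  qed
  finally show ?thesis using X(3) by simp
qed

end
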